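(* Let $\mathcal G$ be a connected unweighted graph on $n\ge3$ nodes with adjacency matrix $A_{\mathcal G}$, and let $$\|A_{\mathcal G}\|_{\mathcal S_{0,1}}:=\max\Big\{\max_{1\le i\le n}\|A_{\mathcal G}(i,\cdot)\|_0,\ \max_{1\le j\le n}\|A_{\mathcal G}(\cdot,j)\|_0\Big\},$$ where $A_{\mathcal G}(i,\cdot)$ is the $i$th row, $A_{\mathcal G}(\cdot,j)$ the $j$th column, and $\|\cdot\|_0$ counts nonzero entries. Then $$\left(\rho_{ss}(L_{\mathcal G};M_n)+\frac1{2n}\right)\|A_{\mathcal G}\|_{\mathcal S_{0,1}}\ \ge\ \frac{n-1}2.$$
   Context: Graphs are finite, simple, undirected. $L_{\mathcal G}$ is the graph Laplacian (degree matrix minus adjacency matrix) with eigenvalues $0=\lambda_1<\lambda_2\le\dots\le\lambda_n$, $M_n=I_n-\frac1nJ_n$ is the centering matrix, and $\rho_{ss}(L_{\mathcal G};M_n)=\frac12\sum_{i=2}^n\lambda_i^{-1}$ is the performance measure of the first-order consensus network $\dot x=-L_{\mathcal G}x+\xi$, $y=M_nx$. *)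

theory Defs
  imports
    "Graph_Theory.Graph_Theory"
    "Jordan_Normal_Form.Char_Poly"
begin

text \<open>
  Graphs are symmetric loop-free sets of arcs. The two arcs of an undirected edge both belong
  to the arc set, so \<^const>\<open>out_degree\<close> is the usual vertex degree. All matrices below are
  indexed from 0, and the vertices of a graph on \<open>n\<close> nodes are accordingly \<open>0, \<dots>, n - 1\<close>.
\<close>

definition adjacency_mat :: "nat \<Rightarrow> nat pair_pre_digraph \<Rightarrow> real mat" where
  "adjacency_mat n G = mat n n (\<lambda>(i, j). if (i, j) \<in> parcs G then 1 else 0)"

definition degree_mat :: "nat \<Rightarrow> nat pair_pre_digraph \<Rightarrow> real mat" where
  "degree_mat n G = mat_diag n (\<lambda>i. real (out_degree (with_proj G) i))"

definition laplacian_mat :: "nat \<Rightarrow> nat pair_pre_digraph \<Rightarrow> real mat" where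
  "laplacian_mat n G = degree_mat n G - adjacency_mat n G"

text \<open>
  Real eigenvalues listed in increasing order, each repeated according to its algebraic
  multiplicity. For a symmetric \<open>n \<times> n\<close> matrix the list has length \<open>n\<close>.
\<close>

definition eigenvalue_list :: "real mat \<Rightarrow> real list" where
  "eigenvalue_list A = sorted_list_of_multiset (proots (char_poly A))"

text \<open>
  The eigenvalue \<open>\<lambda>\<^sub>i\<close> is counted from 1, so \<open>\<lambda>\<^sub>1\<close> is the smallest one.
\<close>

definition ordered_eigenvalue :: "real mat \<Rightarrow> nat \<Rightarrow> real" where
  "ordered_eigenvalue A i = eigenvalue_list A ! (i - 1)"

text \<open>
  The performance measure \<open>\<rho>\<^sub>s\<^sub>s(L; M\<^sub>n)\<close> of the consensus network with state matrix \<open>- L\<close>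
  and output matrix \<open>M\<^sub>n = I\<^sub>n - J\<^sub>n / n\<close>. The zero eigenvalue \<open>\<lambda>\<^sub>1\<close> belongs to the
  consensus mode, which \<open>M\<^sub>n\<close> removes from the output.
\<close>

definition rho_ss_centered :: "real mat \<Rightarrow> real" where
  "rho_ss_centered L = (1/2) * (\<Sum>i = 2..dim_row L. inverse (ordered_eigenvalue L i))"

definition zero_norm_vec :: "real vec \<Rightarrow> nat" where
  "zero_norm_vec v = card {i. i < dim_vec v \<and> v $ i \<noteq> 0}"

definition norm_S01 :: "real mat \<Rightarrow> nat" where
  "norm_S01 A = max
     (Max ((\<lambda>i. zero_norm_vec (row A i)) ` {..<dim_row A}))
     (Max ((\<lambda>j. zero_norm_vec (col A j)) ` {..<dim_col A}))"

end

theory Submission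
  imports Defs "Jordan_Normal_Form.Schur_Decomposition"
begin

text \<open>
  Write \<open>d\<^sub>i\<close> for the vertex degrees, \<open>d\<close> for their maximum, which is what
  \<open>\<parallel>A\<parallel>\<close> counts, and \<open>\<lambda>\<^sub>2, \<dots>, \<lambda>\<^sub>n\<close> for the nonzero Laplacian eigenvalues. After
  multiplication by 2 the claim is \<open>d * (\<Sum> 1/\<lambda>\<^sub>i + 1/n) \<ge> n - 1\<close>.

  The convexity bound \<open>\<Sum> 1/\<lambda>\<^sub>i \<ge> (n-1)\<^sup>2 / \<Sum> \<lambda>\<^sub>i\<close> is too weak, because it uses only the first moment of
  the spectrum. Equality holds for the complete regular multipartite graphs, whose nonzero eigenvalues
  are \<open>d\<close> and \<open>n\<close>. This suggests to bound \<open>1/\<lambda>\<close> from below by the quadratic polynomial in \<open>\<lambda>\<close>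
  that is tangent to it at \<open>d\<close> and meets it at \<open>n\<close>. The difference is
  \<open>(d - \<lambda>)\<^sup>2 (n - \<lambda>) / (n d\<^sup>2 \<lambda>)\<close>, which is nonnegative exactly because the Laplacian eigenvalues
  of a simple graph do not exceed \<open>n\<close> (\<open>inverse_ge_quadratic\<close>, \<open>lap_eigenvalue_bounds\<close>).

  Summed over the spectrum, the quadratic polynomial involves only \<open>\<Sum> \<lambda>\<^sub>i = \<Sum> d\<^sub>i\<close> and
  \<open>\<Sum> \<lambda>\<^sub>i\<^sup>2 = \<Sum> (d\<^sub>i\<^sup>2 + d\<^sub>i)\<close>, the traces of \<open>L\<close> and \<open>L\<^sup>2\<close>, and what remains of the claim is
  \<open>\<Sum> ((d - d\<^sub>i) (n - 1) + (d - d\<^sub>i)\<^sup>2) \<ge> 0\<close>.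

  The eigenvalues are defined as roots of the characteristic polynomial with algebraic multiplicity.
  So two facts about real symmetric matrices are needed: the characteristic polynomial splits
  over the reals (\<open>symmetric_char_poly_splits\<close>), and 0 is a simple root when the kernel is a line
  (\<open>symmetric_zero_eigenvalue_simple\<close>). Both traces are read off from a real Schur form.
\<close>

section \<open>Spectra of real symmetric matrices\<close>

lemma symmetric_scalar_prod_swap:
  fixes A :: "'a :: comm_semiring_0 mat"
  assumes A: "A \<in> carrier_mat n n" and sym: "A\<^sup>T = A"
    and v: "v \<in> carrier_vec n" and w: "w \<in> carrier_vec n"
  shows "(A *\<^sub>v v) \<bullet> w = v \<bullet> (A *\<^sub>v w)"
  using transpose_vec_mult_scalar[OF A w v] sym A v w
  by (metis comm_scalar_prod mult_mat_vec_carrier)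

lemma scalar_prod_self:
  fixes v :: "real vec"
  assumes "v \<in> carrier_vec n"
  shows "v \<bullet> v = (\<Sum>i<n. (v $ i)\<^sup>2)"
  using assms by (simp add: scalar_prod_def atLeast0LessThan power2_eq_square)

lemma scalar_prod_self_eq_0:
  fixes v :: "real vec"
  assumes "v \<in> carrier_vec n"
  shows "v \<bullet> v = 0 \<longleftrightarrow> v = 0\<^sub>v n"
  using assms by (auto simp: scalar_prod_self[OF assms] sum_nonneg_eq_0_iff vec_eq_iff)

text \<open>
  For a complex eigenvector \<open>x + \<i> y\<close>, symmetry gives \<open>Ax \<bullet> y = x \<bullet> Ay\<close>. Expanding both sides by the
  real and imaginary parts of the eigenvector equation leaves \<open>Im z (x \<bullet> x + y \<bullet> y) = 0\<close>.
\<close>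

lemma symmetric_eigenvalue_real:
  fixes A :: "real mat"
  assumes A: "A \<in> carrier_mat n n" and sym: "A\<^sup>T = A"
    and ev: "eigenvalue (map_mat complex_of_real A) z"
  shows "Im z = 0"
proof -
  obtain v where v: "v \<in> carrier_vec n" and v0: "v \<noteq> 0\<^sub>v n"
    and Av: "map_mat complex_of_real A *\<^sub>v v = z \<cdot>\<^sub>v v"
    using ev A unfolding eigenvalue_def eigenvector_def by auto
  define x where "x = map_vec Re v"
  define y where "y = map_vec Im v"
  have x: "x \<in> carrier_vec n" and y: "y \<in> carrier_vec n"
    using v by (auto simp: x_def y_def)
  have Av_i: "(\<Sum>j<n. of_real (A $$ (i, j)) * v $ j) = z * v $ i" if "i < n" for i
    using arg_cong[OF Av, of "\<lambda>u. u $ i"] that A v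
    by (simp add: scalar_prod_def atLeast0LessThan)
  have Ax: "A *\<^sub>v x = Re z \<cdot>\<^sub>v x - Im z \<cdot>\<^sub>v y"
  proof (rule eq_vecI)
    fix i assume "i < dim_vec (Re z \<cdot>\<^sub>v x - Im z \<cdot>\<^sub>v y)"
    then have i: "i < n" using y by simp
    show "(A *\<^sub>v x) $ i = (Re z \<cdot>\<^sub>v x - Im z \<cdot>\<^sub>v y) $ i"
      using arg_cong[OF Av_i[OF i], of Re] i A v
      by (simp add: scalar_prod_def atLeast0LessThan x_def y_def)
  qed (use A y in auto)
  have Ay: "A *\<^sub>v y = Im z \<cdot>\<^sub>v x + Re z \<cdot>\<^sub>v y"
  proof (rule eq_vecI)
    fix i assume "i < dim_vec (Im z \<cdot>\<^sub>v x + Re z \<cdot>\<^sub>v y)"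
    then have i: "i < n" using y by simp
    show "(A *\<^sub>v y) $ i = (Im z \<cdot>\<^sub>v x + Re z \<cdot>\<^sub>v y) $ i"
      using arg_cong[OF Av_i[OF i], of Im] i A v
      by (simp add: scalar_prod_def atLeast0LessThan x_def y_def)
  qed (use A y in auto)
  have "(A *\<^sub>v x) \<bullet> y = x \<bullet> (A *\<^sub>v y)"
    by (rule symmetric_scalar_prod_swap[OF A sym x y])
  then have "Im z * (x \<bullet> x + y \<bullet> y) = 0"
    using x y unfolding Ax Ay
    by (simp add: minus_scalar_prod_distrib[of _ n] scalar_prod_add_distrib[of _ n] algebra_simps)
  moreover have "x \<bullet> x + y \<bullet> y \<noteq> 0"
  proof
    assume "x \<bullet> x + y \<bullet> y = 0"
    moreover have "0 \<le> x \<bullet> x" "0 \<le> y \<bullet> y"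
      by (simp_all add: scalar_prod_self[OF x] scalar_prod_self[OF y] sum_nonneg)
    ultimately have "x = 0\<^sub>v n" "y = 0\<^sub>v n"
      using scalar_prod_self_eq_0 x y by (metis add_nonneg_eq_0_iff)+
    then have "v = 0\<^sub>v n"
      using v by (auto simp: x_def y_def vec_eq_iff complex_eq_iff)
    then show False using v0 by simp
  qed
  ultimately show ?thesis by simp
qed

text \<open>
  The characteristic polynomial splits over the complex numbers, where all its roots are real. The
  factorization descends because the embedding of real into complex polynomials is injective.
\<close>

lemma symmetric_char_poly_splits:
  fixes A :: "real mat"
  assumes A: "A \<in> carrier_mat n n" and sym: "A\<^sup>T = A"
  shows "\<exists>es. char_poly A = (\<Prod>e\<leftarrow>es. [:- e, 1:])"
proof -
  interpret of_real_poly: map_poly_inj_idom_hom complex_of_real ..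
  have A': "map_mat complex_of_real A \<in> carrier_mat n n" using A by simp
  obtain zs where zs: "char_poly (map_mat complex_of_real A) = (\<Prod>z\<leftarrow>zs. [:- z, 1:])"
    using char_poly_factorized[OF A'] by auto
  have re: "complex_of_real (Re z) = z" if "z \<in> set zs" for z
  proof -
    have "poly (char_poly (map_mat complex_of_real A)) z = 0"
      unfolding zs poly_prod_list using that by (auto simp: prod_list_zero_iff)
    then show ?thesis
      using symmetric_eigenvalue_real[OF A sym] eigenvalue_root_char_poly[OF A']
      by (simp add: complex_eq_iff)
  qed
  have "map_poly complex_of_real (char_poly A) = (\<Prod>z\<leftarrow>zs. [:- z, 1:])"
    using of_real_hom.char_poly_hom[OF A] zs by metis
  also have "\<dots> = (\<Prod>z\<leftarrow>zs. map_poly complex_of_real [:- Re z, 1:])"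
    by (rule arg_cong[where f = prod_list], rule map_cong) (auto simp: re)
  also have "\<dots> = map_poly complex_of_real (\<Prod>z\<leftarrow>zs. [:- Re z, 1:])"
    by (simp add: of_real_poly.hom_prod_list o_def)
  finally have "char_poly A = (\<Prod>e\<leftarrow>map Re zs. [:- e, 1:])"
    by (simp add: o_def)
  then show ?thesis by blast
qed

lemma char_poly_eigenvalue_list:
  fixes A :: "real mat"
  assumes A: "A \<in> carrier_mat n n" and sym: "A\<^sup>T = A"
  shows "char_poly A = (\<Prod>e\<leftarrow>eigenvalue_list A. [:- e, 1:])"
    and "length (eigenvalue_list A) = n"
proof -
  obtain es where es: "char_poly A = (\<Prod>e\<leftarrow>es. [:- e, 1:])"
    using symmetric_char_poly_splits[OF A sym] by blast
  have "proots (char_poly A) = (\<Sum>p\<leftarrow>map (\<lambda>e. [:- e, 1:]) es. proots p)"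
    unfolding es by (subst proots_prod_list[symmetric]) auto
  also have "\<dots> = mset es" by (induction es) auto
  finally have el: "mset (eigenvalue_list A) = mset es"
    by (simp add: eigenvalue_list_def)
  have "(\<Prod>e\<leftarrow>es. [:- e, 1:]) = (\<Prod>e\<leftarrow>eigenvalue_list A. [:- e, 1:])"
    using el by (metis mset_map prod_mset_prod_list)
  then show *: "char_poly A = (\<Prod>e\<leftarrow>eigenvalue_list A. [:- e, 1:])"
    using es by simp
  then have "degree (char_poly A) = length (eigenvalue_list A)"
    by (simp only: degree_linear_factors)
  then show "length (eigenvalue_list A) = n"
    using degree_monic_char_poly[OF A] by metis
qed

lemma eigenvalue_list_iff:
  fixes A :: "real mat"
  assumes A: "A \<in> carrier_mat n n" and sym: "A\<^sup>T = A"
  shows "e \<in> set (eigenvalue_list A) \<longleftrightarrow> eigenvalue A e"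
  unfolding eigenvalue_root_char_poly[OF A] char_poly_eigenvalue_list(1)[OF A sym]
  by (auto simp: poly_prod_list prod_list_zero_iff)

section \<open>Traces and the zero eigenvalue via Schur form\<close>

lemma trace_mult_commute:
  fixes X Y :: "'a :: comm_semiring_0 mat"
  assumes "X \<in> carrier_mat n n" and "Y \<in> carrier_mat n n"
  shows "(\<Sum>i<n. (X * Y) $$ (i, i)) = (\<Sum>i<n. (Y * X) $$ (i, i))"
proof -
  have "(\<Sum>i<n. (X * Y) $$ (i, i)) = (\<Sum>i<n. \<Sum>j<n. X $$ (i, j) * Y $$ (j, i))"
    using assms by (auto simp: scalar_prod_def atLeast0LessThan intro!: sum.cong)
  also have "\<dots> = (\<Sum>j<n. \<Sum>i<n. Y $$ (j, i) * X $$ (i, j))"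
    by (subst sum.swap) (simp add: mult.commute)
  also have "\<dots> = (\<Sum>i<n. (Y * X) $$ (i, i))"
    using assms by (auto simp: scalar_prod_def atLeast0LessThan intro!: sum.cong)
  finally show ?thesis .
qed

lemma obtain_schur_form:
  fixes A :: "real mat"
  assumes A: "A \<in> carrier_mat n n" and cp: "char_poly A = (\<Prod>e\<leftarrow>es. [:- e, 1:])"
  obtains B P Q where "similar_mat_wit A B P Q" "upper_triangular B" "diag_mat B = es"
  using schur_decomposition[OF A cp] by (metis prod_cases3)

lemma trace_similar:
  fixes A :: "'a :: comm_semiring_1 mat"
  assumes sim: "similar_mat_wit A B P Q" and A: "A \<in> carrier_mat n n"
  shows "(\<Sum>i<n. A $$ (i, i)) = (\<Sum>i<n. B $$ (i, i))"
proof -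
  note w = similar_mat_witD2[OF A sim]
  have "(\<Sum>i<n. A $$ (i, i)) = (\<Sum>i<n. (P * (B * Q)) $$ (i, i))"
    using w by (simp add: assoc_mult_mat[of _ n n _ n _ n])
  also have "\<dots> = (\<Sum>i<n. (B * Q * P) $$ (i, i))"
    using w by (intro trace_mult_commute) auto
  also have "B * Q * P = B"
    using w by (simp add: assoc_mult_mat[of _ n n _ n _ n])
  finally show ?thesis .
qed

text \<open>
  Similarity preserves the trace of a matrix and of its square, and an upper triangular
  matrix has the squares of its diagonal entries on the diagonal of its square.
\<close>

lemma sum_eigenvalues_eq_trace:
  fixes A :: "real mat"
  assumes A: "A \<in> carrier_mat n n" and cp: "char_poly A = (\<Prod>e\<leftarrow>es. [:- e, 1:])"
  shows "sum_list es = (\<Sum>i<n. A $$ (i, i))"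
    and "(\<Sum>e\<leftarrow>es. e\<^sup>2) = (\<Sum>i<n. \<Sum>j<n. A $$ (i, j) * A $$ (j, i))"
proof -
  obtain B P Q where sim: "similar_mat_wit A B P Q" and ut: "upper_triangular B"
    and diag: "diag_mat B = es"
    using obtain_schur_form[OF A cp] .
  have B: "B \<in> carrier_mat n n" using similar_mat_witD2[OF A sim] by simp
  have es: "es = map (\<lambda>i. B $$ (i, i)) [0..<n]"
    using B diag by (simp add: diag_mat_def)
  show "sum_list es = (\<Sum>i<n. A $$ (i, i))"
    unfolding trace_similar[OF sim A] es
    by (simp add: sum_list_sum_nth atLeast0LessThan)
  have sim2: "similar_mat_wit (A ^\<^sub>m 2) (B ^\<^sub>m 2) P Q"
    by (rule similar_mat_wit_pow[OF sim])
  have sq: "M ^\<^sub>m 2 = M * M" if "M \<in> carrier_mat n n" for M :: "real mat"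
    using that by (simp add: numeral_2_eq_2)
  have diag2: "(B * B) $$ (i, i) = (B $$ (i, i))\<^sup>2" if i: "i < n" for i
  proof -
    have "(B * B) $$ (i, i) = (\<Sum>j<n. B $$ (i, j) * B $$ (j, i))"
      using i B by (simp add: scalar_prod_def atLeast0LessThan)
    also have "\<dots> = (\<Sum>j<n. if j = i then (B $$ (i, i))\<^sup>2 else 0)"
      using ut B i
      by (intro sum.cong) (auto simp: power2_eq_square upper_triangular_def neq_iff)
    finally show ?thesis using i by simp
  qed
  have "(\<Sum>i<n. (A * A) $$ (i, i)) = (\<Sum>i<n. (B $$ (i, i))\<^sup>2)"
    using trace_similar[OF sim2, of n] A B diag2 by (simp add: sq)
  then show "(\<Sum>e\<leftarrow>es. e\<^sup>2) = (\<Sum>i<n. \<Sum>j<n. A $$ (i, j) * A $$ (j, i))"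
    unfolding es using A
    by (simp add: sum_list_sum_nth atLeast0LessThan scalar_prod_def)
qed

text \<open>
  The reason that a symmetric matrix has no nontrivial Jordan block for the eigenvalue 0:
  \<open>Av \<bullet> Av = v \<bullet> A(Av)\<close>.
\<close>

lemma symmetric_kernel_square:
  fixes A :: "real mat"
  assumes A: "A \<in> carrier_mat n n" and sym: "A\<^sup>T = A" and v: "v \<in> carrier_vec n"
    and AAv: "A *\<^sub>v (A *\<^sub>v v) = 0\<^sub>v n"
  shows "A *\<^sub>v v = 0\<^sub>v n"
proof -
  have w: "A *\<^sub>v v \<in> carrier_vec n" using A v by simp
  have "(A *\<^sub>v v) \<bullet> (A *\<^sub>v v) = v \<bullet> (A *\<^sub>v (A *\<^sub>v v))"
    by (rule symmetric_scalar_prod_swap[OF A sym v w])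
  also have "\<dots> = 0" using v by (simp add: AAv)
  finally show ?thesis using scalar_prod_self_eq_0[OF w] by simp
qed

text \<open>
  Suppose that 0 is a double root and put both zeros first on the diagonal of a Schur form
  \<open>A P = P B\<close>. The first column of \<open>P\<close> is then in the kernel of \<open>A\<close>, and the second is mapped
  to a multiple of the first, hence is in the kernel of \<open>A\<^sup>2\<close>, which is the kernel of \<open>A\<close>. Two columns
  of an invertible matrix cannot both be on the line spanned by \<open>u\<close>.
\<close>

lemma symmetric_zero_eigenvalue_simple:
  fixes A :: "real mat"
  assumes A: "A \<in> carrier_mat n n" and sym: "A\<^sup>T = A"
    and ker: "\<And>v. v \<in> carrier_vec n \<Longrightarrow> A *\<^sub>v v = 0\<^sub>v n \<Longrightarrow> \<exists>c. v = c \<cdot>\<^sub>v u"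
    and u: "u \<in> carrier_vec n"
  shows "char_poly A \<noteq> (\<Prod>e\<leftarrow>0 # 0 # es. [:- e, 1:])"
proof
  assume cp: "char_poly A = (\<Prod>e\<leftarrow>0 # 0 # es. [:- e, 1:])"
  obtain B P Q where sim: "similar_mat_wit A B P Q" and ut: "upper_triangular B"
    and diag: "diag_mat B = 0 # 0 # es"
    using obtain_schur_form[OF A cp] .
  note w = similar_mat_witD2[OF A sim]
  have "length (diag_mat B) = n" using w by (simp add: diag_mat_def)
  then have n: "1 < n" "0 < n" by (auto simp: diag)
  have B00: "B $$ (0, 0) = 0" and B11: "B $$ (1, 1) = 0"
    using arg_cong[OF diag, of "\<lambda>xs. xs ! 0"] arg_cong[OF diag, of "\<lambda>xs. xs ! 1"] n w
    by (auto simp: diag_mat_def)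
  have AP: "A * P = P * B"
    using w by (simp add: assoc_mult_mat[of _ n n _ n _ n])
  have colB0: "col B 0 = 0\<^sub>v n"
    using w n ut B00 by (auto simp: vec_eq_iff upper_triangular_def)
  have colB1: "col B 1 = B $$ (0, 1) \<cdot>\<^sub>v unit_vec n 0"
  proof (rule eq_vecI)
    fix i assume "i < dim_vec (B $$ (0, 1) \<cdot>\<^sub>v unit_vec n 0)"
    then have "i < n" by simp
    then show "col B 1 $ i = (B $$ (0, 1) \<cdot>\<^sub>v unit_vec n 0) $ i"
      using w(5) n ut B11 unfolding upper_triangular_def
      by (cases "i = 0"; cases "i = 1") auto
  qed (use w(5) in simp)
  have AcolP: "A *\<^sub>v col P j = P *\<^sub>v col B j" if "j < n" for j
    using that w by (metis AP col_mult2)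
  have p: "col P 0 \<in> carrier_vec n" "col P 1 \<in> carrier_vec n" using w by auto
  have Ap0: "A *\<^sub>v col P 0 = 0\<^sub>v n"
    using AcolP[OF n(2)] w(6) unfolding colB0 by (auto simp: vec_eq_iff)
  have Pe: "P *\<^sub>v unit_vec n 0 = col P 0"
    using col_mult2[OF w(6) one_carrier_mat n(2)] w(6) n by simp
  have "A *\<^sub>v col P 1 = B $$ (0, 1) \<cdot>\<^sub>v col P 0"
    using AcolP[OF n(1)] w(6) Pe unfolding colB1 by (simp add: mult_mat_vec[of _ n n])
  then have "A *\<^sub>v (A *\<^sub>v col P 1) = B $$ (0, 1) \<cdot>\<^sub>v 0\<^sub>v n"
    using A p by (simp add: mult_mat_vec[of _ n n] Ap0)
  also have "\<dots> = 0\<^sub>v n" by (rule eq_vecI) simp_all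
  finally have "A *\<^sub>v (A *\<^sub>v col P 1) = 0\<^sub>v n" .
  then have Ap1: "A *\<^sub>v col P 1 = 0\<^sub>v n"
    by (rule symmetric_kernel_square[OF A sym p(2)])
  obtain a where a: "col P 0 = a \<cdot>\<^sub>v u" using ker[OF p(1) Ap0] by blast
  obtain b where b: "col P 1 = b \<cdot>\<^sub>v u" using ker[OF p(2) Ap1] by blast
  have QP: "row Q i \<bullet> col P j = (if i = j then 1 else 0)" if "i < n" "j < n" for i j
  proof -
    have "row Q i \<bullet> col P j = (Q * P) $$ (i, j)" using that w(6,7) by simp
    then show ?thesis unfolding w(2) using that by simp
  qed
  have q: "row Q 0 \<in> carrier_vec n" "row Q 1 \<in> carrier_vec n" using w(7) by auto
  \<comment> \<open>The first two equations force \<open>b = 0\<close>, which contradicts the third.\<close>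
  have "a * (row Q 0 \<bullet> u) = 1" using QP[of 0 0] n q u unfolding a by simp
  moreover have "b * (row Q 0 \<bullet> u) = 0" using QP[of 0 1] n q u unfolding b by simp
  moreover have "b * (row Q 1 \<bullet> u) = 1" using QP[of 1 1] n q u unfolding b by simp
  ultimately show False by auto
qed



section \<open>The Laplacian of a graph\<close>

locale graph_on_initial_segment = pair_graph G
  for G :: "nat pair_pre_digraph" +
  fixes n :: nat
  assumes pverts_eq: "pverts G = {..<n}"
begin

abbreviation adj :: "real mat" where "adj \<equiv> adjacency_mat n G"
abbreviation lap :: "real mat" where "lap \<equiv> laplacian_mat n G"
abbreviation deg :: "nat \<Rightarrow> real" where "deg i \<equiv> real (out_degree (with_proj G) i)"

lemma adj_carrier: "adj \<in> carrier_mat n n"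
  by (simp add: adjacency_mat_def)

lemma lap_carrier: "lap \<in> carrier_mat n n"
  by (auto simp: laplacian_mat_def degree_mat_def adjacency_mat_def)

lemma adj_index: "i < n \<Longrightarrow> j < n \<Longrightarrow> adj $$ (i, j) = (if (i, j) \<in> parcs G then 1 else 0)"
  by (simp add: adjacency_mat_def)

lemma adj_sym: "i < n \<Longrightarrow> j < n \<Longrightarrow> adj $$ (j, i) = adj $$ (i, j)"
  using pair_sym_arcs by (auto simp: adj_index symmetric_def sym_def)

lemma adj_diag: "i < n \<Longrightarrow> adj $$ (i, i) = 0"
  using pair_no_loops[of "(i, i)"] by (auto simp: adj_index)

lemma lap_index:
  "i < n \<Longrightarrow> j < n \<Longrightarrow> lap $$ (i, j) = (if i = j then deg i else 0) - adj $$ (i, j)"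
  by (simp add: laplacian_mat_def degree_mat_def adjacency_mat_def mat_diag_def)

lemma lap_sym: "lap\<^sup>T = lap"
  using lap_carrier by (intro eq_matI) (auto simp: lap_index adj_sym)

lemma out_degree_eq_card: "out_degree (with_proj G) i = card {j. j < n \<and> (i, j) \<in> parcs G}"
proof -
  have "out_arcs (with_proj G) i = Pair i ` {j. j < n \<and> (i, j) \<in> parcs G}"
    using arc_snd_in_verts pverts_eq by (fastforce simp: out_arcs_def)
  then show ?thesis
    unfolding out_degree_def by (simp add: card_image inj_on_def)
qed

lemma deg_eq_row_sum:
  assumes "i < n"
  shows "deg i = (\<Sum>j<n. adj $$ (i, j))"
proof -
  have "(\<Sum>j<n. adj $$ (i, j)) = (\<Sum>j<n. if (i, j) \<in> parcs G then 1 else 0)"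
    using assms by (simp add: adj_index)
  also have "\<dots> = real (card {j. j < n \<and> (i, j) \<in> parcs G})"
    by (simp add: sum.If_cases) (simp add: Collect_conj_eq lessThan_def)
  finally show ?thesis by (simp add: out_degree_eq_card)
qed

lemma deg_le_norm_S01:
  assumes i: "i < n"
  shows "deg i \<le> real (norm_S01 adj)"
proof -
  have "zero_norm_vec (row adj i) = out_degree (with_proj G) i"
    unfolding zero_norm_vec_def out_degree_eq_card using i adj_carrier
    by (intro arg_cong[where f = card]) (auto simp: adj_index split: if_splits)
  moreover have "zero_norm_vec (row adj i) \<le> Max ((\<lambda>i. zero_norm_vec (row adj i)) ` {..<dim_row adj})"
    using i adj_carrier by (intro Max_ge) auto
  ultimately show ?thesis by (simp add: norm_S01_def)
qed

lemma lap_mult_vec_index: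
  assumes v: "v \<in> carrier_vec n" and i: "i < n"
  shows "(lap *\<^sub>v v) $ i = (\<Sum>j<n. adj $$ (i, j) * (v $ i - v $ j))"
proof -
  have "(lap *\<^sub>v v) $ i = (\<Sum>j<n. lap $$ (i, j) * v $ j)"
    using v i lap_carrier by (simp add: scalar_prod_def atLeast0LessThan)
  also have "\<dots> = (\<Sum>j<n. (if i = j then deg i * v $ i else 0) - adj $$ (i, j) * v $ j)"
    using i by (intro sum.cong) (auto simp: lap_index algebra_simps)
  also have "\<dots> = deg i * v $ i - (\<Sum>j<n. adj $$ (i, j) * v $ j)"
    using i by (simp add: sum_subtractf)
  also have "\<dots> = (\<Sum>j<n. adj $$ (i, j) * (v $ i - v $ j))"
    by (simp add: deg_eq_row_sum[OF i] sum_distrib_left sum_subtractf algebra_simps)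
  finally show ?thesis .
qed

lemma lap_quadratic_form:
  assumes v: "v \<in> carrier_vec n"
  shows "v \<bullet> (lap *\<^sub>v v) = (\<Sum>i<n. \<Sum>j<n. adj $$ (i, j) * (v $ i - v $ j)\<^sup>2) / 2"
proof -
  let ?S = "\<Sum>i<n. \<Sum>j<n. adj $$ (i, j) * (v $ i * (v $ i - v $ j))"
  have "v \<bullet> (lap *\<^sub>v v) = (\<Sum>i<n. v $ i * (lap *\<^sub>v v) $ i)"
    using v lap_carrier by (simp add: scalar_prod_def atLeast0LessThan del: index_mult_mat_vec)
  also have "\<dots> = ?S"
    by (simp add: lap_mult_vec_index[OF v] sum_distrib_left mult.left_commute
      del: index_mult_mat_vec)
  finally have 1: "v \<bullet> (lap *\<^sub>v v) = ?S" .
  have "?S = (\<Sum>i<n. \<Sum>j<n. adj $$ (j, i) * (v $ j * (v $ j - v $ i)))"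
    by (rule sum.swap)
  also have "\<dots> = (\<Sum>i<n. \<Sum>j<n. adj $$ (i, j) * (v $ j * (v $ j - v $ i)))"
    by (intro sum.cong) (auto simp: adj_sym)
  finally have "?S + ?S = ?S + (\<Sum>i<n. \<Sum>j<n. adj $$ (i, j) * (v $ j * (v $ j - v $ i)))"
    by simp
  also have "\<dots> = (\<Sum>i<n. \<Sum>j<n. adj $$ (i, j) * (v $ i - v $ j)\<^sup>2)"
    unfolding sum.distrib[symmetric]
    by (intro sum.cong refl) (simp add: power2_eq_square algebra_simps)
  finally show ?thesis using 1 by simp
qed

lemma lap_quadratic_form_nonneg:
  assumes v: "v \<in> carrier_vec n"
  shows "0 \<le> v \<bullet> (lap *\<^sub>v v)"
  unfolding lap_quadratic_form[OF v]
  by (intro divide_nonneg_pos sum_nonneg) (auto simp: adj_index)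

text \<open>
  Bounding every adjacency entry by 1 replaces the graph by the complete graph, whose
  quadratic form is \<open>n (v \<bullet> v) - (\<Sum> v\<^sub>i)\<^sup>2\<close>.
\<close>

lemma lap_quadratic_form_le:
  assumes v: "v \<in> carrier_vec n"
  shows "v \<bullet> (lap *\<^sub>v v) \<le> real n * (v \<bullet> v)"
proof -
  have "(\<Sum>i<n. \<Sum>j<n. adj $$ (i, j) * (v $ i - v $ j)\<^sup>2) \<le> (\<Sum>i<n. \<Sum>j<n. (v $ i - v $ j)\<^sup>2)"
    by (intro sum_mono) (auto simp: adj_index)
  also have "\<dots> = (\<Sum>i<n. \<Sum>j<n. (v $ i)\<^sup>2 + (v $ j)\<^sup>2 - 2 * (v $ i * v $ j))"
    by (intro sum.cong refl) (simp add: power2_diff)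
  also have "\<dots> = 2 * (real n * (v \<bullet> v)) - 2 * (\<Sum>i<n. v $ i)\<^sup>2"
  proof -
    have "(\<Sum>i<n. \<Sum>j<n. (v $ i)\<^sup>2) = real n * (v \<bullet> v)"
      and "(\<Sum>i<n. \<Sum>j<n. (v $ j)\<^sup>2) = real n * (v \<bullet> v)"
      unfolding scalar_prod_self[OF v] by (simp_all add: sum_distrib_left)
    moreover have "(\<Sum>i<n. \<Sum>j<n. 2 * (v $ i * v $ j)) = 2 * (\<Sum>i<n. v $ i)\<^sup>2"
      unfolding sum_distrib_left[symmetric] power2_eq_square sum_product by simp
    ultimately show ?thesis unfolding sum.distrib sum_subtractf by simp
  qed
  also have "\<dots> \<le> 2 * (real n * (v \<bullet> v))" by simp
  finally show ?thesis by (simp add: lap_quadratic_form[OF v])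
qed

lemma lap_eigenvalue_bounds:
  assumes "eigenvalue lap e"
  shows "0 \<le> e" and "e \<le> real n"
proof -
  obtain v where v: "v \<in> carrier_vec n" and v0: "v \<noteq> 0\<^sub>v n" and ev: "lap *\<^sub>v v = e \<cdot>\<^sub>v v"
    using assms lap_carrier unfolding eigenvalue_def eigenvector_def by auto
  have "0 \<le> v \<bullet> v" by (simp add: scalar_prod_self[OF v] sum_nonneg)
  then have pos: "0 < v \<bullet> v" using scalar_prod_self_eq_0[OF v] v0 by linarith
  have q: "v \<bullet> (lap *\<^sub>v v) = e * (v \<bullet> v)" using v by (simp add: ev)
  show "0 \<le> e"
    using lap_quadratic_form_nonneg[OF v] pos unfolding q by (simp add: zero_le_mult_iff)
  show "e \<le> real n"
    using lap_quadratic_form_le[OF v] pos unfolding q by simp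
qed

lemma lap_zero_eigenvalue:
  assumes "0 < n"
  shows "eigenvalue lap 0"
proof -
  let ?u = "vec n (\<lambda>_. 1) :: real vec"
  have "lap *\<^sub>v ?u = 0 \<cdot>\<^sub>v ?u"
    using lap_carrier
    by (intro eq_vecI) (auto simp: lap_mult_vec_index simp del: index_mult_mat_vec)
  moreover have "?u \<noteq> 0\<^sub>v n" using assms by (auto simp: vec_eq_iff)
  ultimately have "eigenvector lap ?u 0"
    using lap_carrier unfolding eigenvector_def by auto
  then show ?thesis unfolding eigenvalue_def by blast
qed

text \<open>
  The quadratic form vanishes on the kernel, and it is a sum of nonnegative terms.
\<close>

lemma lap_kernel_constant_on_arcs:
  assumes v: "v \<in> carrier_vec n" and ker: "lap *\<^sub>v v = 0\<^sub>v n" and arc: "(i, j) \<in> parcs G"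
  shows "v $ i = v $ j"
proof -
  have ij: "i < n" "j < n"
    using arc_fst_in_verts[OF arc] arc_snd_in_verts[OF arc] pverts_eq by auto
  have "(\<Sum>i<n. \<Sum>j<n. adj $$ (i, j) * (v $ i - v $ j)\<^sup>2) = 0"
    using lap_quadratic_form[OF v] v by (simp add: ker)
  moreover have nonneg: "0 \<le> adj $$ (i, j) * (v $ i - v $ j)\<^sup>2" if "i < n" "j < n" for i j
    using that by (simp add: adj_index)
  ultimately have "(\<Sum>j<n. adj $$ (i, j) * (v $ i - v $ j)\<^sup>2) = 0"
    using ij by (subst (asm) sum_nonneg_eq_0_iff) (auto intro!: sum_nonneg)
  then have "adj $$ (i, j) * (v $ i - v $ j)\<^sup>2 = 0"
    using ij nonneg by (subst (asm) sum_nonneg_eq_0_iff) auto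
  then show ?thesis using ij arc by (simp add: adj_index)
qed

lemma lap_kernel_constant:
  assumes conn: "Digraph_Component.connected (with_proj G)"
    and v: "v \<in> carrier_vec n" and ker: "lap *\<^sub>v v = 0\<^sub>v n"
  shows "\<exists>c. v = c \<cdot>\<^sub>v vec n (\<lambda>_. 1)"
proof -
  have same: "v $ i = v $ j" if ij: "i < n" "j < n" for i j
  proof -
    have "i \<rightarrow>\<^sup>*\<^bsub>with_proj (mk_symmetric (with_proj G))\<^esub> j"
      using conn ij pverts_eq
      unfolding Digraph_Component.connected_def strongly_connected_def by simp
    then show ?thesis
      unfolding reachable_def
    proof (induct rule: rtrancl_on_induct)
      case (step x y)
      from step(2) have "(x, y) \<in> parcs G \<or> (y, x) \<in> parcs G"
        by (auto simp: parcs_mk_symmetric)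
      then have "v $ x = v $ y"
        using lap_kernel_constant_on_arcs[OF v ker, of x y]
          lap_kernel_constant_on_arcs[OF v ker, of y x] by auto
      with step(5) show ?case by (rule trans)
    qed (rule refl)
  qed
  have "v = v $ 0 \<cdot>\<^sub>v vec n (\<lambda>_. 1)"
  proof (rule eq_vecI)
    fix i assume "i < dim_vec (v $ 0 \<cdot>\<^sub>v vec n (\<lambda>_. 1))"
    then have i: "i < n" by simp
    then show "v $ i = (v $ 0 \<cdot>\<^sub>v vec n (\<lambda>_. 1)) $ i"
      using same[OF i, of 0] by auto
  qed (use v in simp)
  then show ?thesis by blast
qed

text \<open>
  By positive semidefiniteness the sorted list of eigenvalues starts with the zero eigenvalue of the
  constant vector. A second zero would come next in the list, against simplicity of the root 0.
\<close>

lemma connected_lap_spectrum: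
  assumes conn: "Digraph_Component.connected (with_proj G)" and n: "0 < n"
  obtains es where "eigenvalue_list lap = 0 # es" and "length es = n - 1"
    and "\<And>e. e \<in> set es \<Longrightarrow> 0 < e \<and> e \<le> real n"
proof -
  note spec = eigenvalue_list_iff[OF lap_carrier lap_sym]
  have bounds: "0 \<le> e \<and> e \<le> real n" if "e \<in> set (eigenvalue_list lap)" for e
    using that lap_eigenvalue_bounds unfolding spec by blast
  have sorted: "sorted (eigenvalue_list lap)"
    by (simp add: eigenvalue_list_def)
  have zero: "0 \<in> set (eigenvalue_list lap)"
    using lap_zero_eigenvalue[OF n] unfolding spec .
  then obtain e0 es where e0: "eigenvalue_list lap = e0 # es"
    by (cases "eigenvalue_list lap") auto
  have "e0 = 0" using sorted zero bounds[of e0] by (auto simp: e0)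
  then have list: "eigenvalue_list lap = 0 # es" using e0 by simp
  have "0 \<notin> set es"
  proof
    assume "0 \<in> set es"
    then obtain e1 fs where e1: "es = e1 # fs" by (cases es) auto
    have "e1 = 0" using sorted \<open>0 \<in> set es\<close> bounds[of e1] by (auto simp: list e1)
    then have "char_poly lap = (\<Prod>e\<leftarrow>0 # 0 # fs. [:- e, 1:])"
      using char_poly_eigenvalue_list(1)[OF lap_carrier lap_sym] by (simp only: list e1)
    moreover have "char_poly lap \<noteq> (\<Prod>e\<leftarrow>0 # 0 # fs. [:- e, 1:])"
      by (rule symmetric_zero_eigenvalue_simple[OF lap_carrier lap_sym])
        (auto intro: lap_kernel_constant[OF conn])
    ultimately show False by contradiction
  qed
  then have "0 < e \<and> e \<le> real n" if "e \<in> set es" for e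
    using bounds[of e] that by (cases "e = 0") (auto simp: list)
  moreover have "length es = n - 1"
    using char_poly_eigenvalue_list(2)[OF lap_carrier lap_sym] by (simp add: list)
  ultimately show ?thesis using that list by blast
qed

lemma sum_lap_eigenvalues: "sum_list (eigenvalue_list lap) = (\<Sum>i<n. deg i)"
  using sum_eigenvalues_eq_trace(1)[OF lap_carrier char_poly_eigenvalue_list(1)[OF lap_carrier lap_sym]]
  by (simp add: lap_index adj_diag)

text \<open>
  Off the diagonal, row \<open>i\<close> of the Laplacian has one entry \<open>-1\<close> for each neighbour of \<open>i\<close>. These
  contribute \<open>deg i\<close> to the diagonal of the square, next to the square of the diagonal entry.
\<close>

lemma sum_lap_eigenvalues_squared:
  "(\<Sum>e\<leftarrow>eigenvalue_list lap. e\<^sup>2) = (\<Sum>i<n. (deg i)\<^sup>2 + deg i)"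
proof -
  have "(\<Sum>j<n. lap $$ (i, j) * lap $$ (j, i)) = (deg i)\<^sup>2 + deg i" if i: "i < n" for i
  proof -
    have "(\<Sum>j<n. lap $$ (i, j) * lap $$ (j, i))
        = (\<Sum>j<n. (if i = j then (deg i)\<^sup>2 else 0) + adj $$ (i, j))"
      using i pair_no_loops[of "(i, i)"] adj_sym[OF i]
      by (intro sum.cong) (auto simp: lap_index adj_index power2_eq_square)
    then show ?thesis using i by (simp add: sum.distrib deg_eq_row_sum)
  qed
  then show ?thesis
    using sum_eigenvalues_eq_trace(2)[OF lap_carrier char_poly_eigenvalue_list(1)[OF lap_carrier lap_sym]]
    by simp
qed

lemma rho_ss_centered_lap:
  assumes "eigenvalue_list lap = 0 # es" and "length es = n - 1"
  shows "rho_ss_centered lap = (\<Sum>e\<leftarrow>es. inverse e) / 2"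
proof -
  have "{2..n} = {0 + 2..<(n - 1) + 2}" if "0 < n" using that by auto
  then have "(\<Sum>i = 2..n. inverse (ordered_eigenvalue lap i))
      = (\<Sum>i = 0..<n - 1. inverse (ordered_eigenvalue lap (i + 2)))"
    by (cases "n = 0") (simp_all only: sum.shift_bounds_nat_ivl, simp_all)
  also have "\<dots> = (\<Sum>e\<leftarrow>es. inverse e)"
    using assms by (simp add: ordered_eigenvalue_def sum_list_sum_nth)
  finally show ?thesis using lap_carrier by (simp add: rho_ss_centered_def)
qed

end

section \<open>The inequality\<close>

text \<open>
  Interpolation of \<open>1/e\<close> with a double node at \<open>d\<close> and a simple node at \<open>m\<close>, multiplied by \<open>m d\<^sup>2\<close>.
\<close>

lemma inverse_ge_quadratic:
  fixes e d m :: real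
  assumes "0 < e" "e \<le> m" "0 < d"
  shows "(2 * d * m + d\<^sup>2) - (m + 2 * d) * e + e\<^sup>2 \<le> m * d\<^sup>2 * inverse e"
proof -
  have "0 \<le> (d - e)\<^sup>2 * (m - e) * inverse e" using assms by simp
  also have "\<dots> = m * d\<^sup>2 * inverse e - ((2 * d * m + d\<^sup>2) - (m + 2 * d) * e + e\<^sup>2)"
    using assms by (simp add: field_simps power2_eq_square power3_eq_cube)
  finally show ?thesis by simp
qed

lemma sum_inverse_ge_quadratic:
  fixes es :: "real list"
  assumes "\<And>e. e \<in> set es \<Longrightarrow> 0 < e \<and> e \<le> m" and "0 < d"
  shows "real (length es) * (2 * d * m + d\<^sup>2) - (m + 2 * d) * sum_list es + (\<Sum>e\<leftarrow>es. e\<^sup>2)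
    \<le> m * d\<^sup>2 * (\<Sum>e\<leftarrow>es. inverse e)"
  using assms(1)
proof (induction es)
  case (Cons e es)
  from Cons inverse_ge_quadratic[of e m d] assms(2) show ?case
    by (fastforce simp: algebra_simps)
qed simp

theorem corollary3:
  fixes G :: "nat pair_pre_digraph" and n :: nat
  assumes "pair_graph G"
    and "pverts G = {..<n}"
    and "Digraph_Component.connected (with_proj G)"
    and "n \<ge> 3"
  shows "(rho_ss_centered (laplacian_mat n G) + 1 / (2 * real n))
           * real (norm_S01 (adjacency_mat n G)) \<ge> (real n - 1) / 2"
proof -
  interpret pair_graph G by fact
  interpret graph_on_initial_segment G n
    by unfold_locales fact
  define d where "d = real (norm_S01 adj)"
  define S where "S = (\<Sum>i<n. deg i)"
  have n: "0 < n" using assms(4) by simp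
  obtain es where list: "eigenvalue_list lap = 0 # es" and len: "length es = n - 1"
    and es: "\<And>e. e \<in> set es \<Longrightarrow> 0 < e \<and> e \<le> real n"
    using connected_lap_spectrum[OF assms(3) n] by blast
  have sum1: "sum_list es = S"
    using sum_lap_eigenvalues by (simp add: list S_def)
  have sum2: "(\<Sum>e\<leftarrow>es. e\<^sup>2) = (\<Sum>i<n. (deg i)\<^sup>2) + S"
    using sum_lap_eigenvalues_squared by (simp add: list S_def sum.distrib)
  have deg_le: "deg i \<le> d" if "i < n" for i
    using deg_le_norm_S01[OF that] by (simp add: d_def)
  \<comment> \<open>A connected graph with more than one vertex has an arc; this shows in the trace, which is the
    sum of a nonempty list of positive eigenvalues.\<close>
  have d: "0 < d"
  proof -
    obtain e fs where efs: "es = e # fs"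
      using len assms(4) by (cases es) auto
    have "0 \<le> sum_list fs"
      using es by (intro sum_list_nonneg) (auto simp: efs less_imp_le)
    then have "0 < sum_list es" using es[of e] by (simp add: efs)
    also have "\<dots> \<le> real n * d"
      unfolding sum1 S_def using sum_bounded_above[of "{..<n}" deg d] deg_le by simp
    finally show ?thesis using n by (simp add: zero_less_mult_iff)
  qed
  define T where "T = (\<Sum>e\<leftarrow>es. inverse e)"
  have quad: "(real n - 1) * (2 * d * real n + d\<^sup>2) - (real n + 2 * d) * S + ((\<Sum>i<n. (deg i)\<^sup>2) + S)
      \<le> real n * d\<^sup>2 * T"
    using sum_inverse_ge_quadratic[of es "real n" d] es d n
    by (simp add: T_def sum1 sum2 len of_nat_diff)
  \<comment> \<open>Since \<open>d\<close> is at least every degree, each summand of the slack is nonnegative.\<close>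
  have "0 \<le> (\<Sum>i<n. (d - deg i) * (real n - 1) + (d - deg i)\<^sup>2)"
    using deg_le n by (intro sum_nonneg add_nonneg_nonneg mult_nonneg_nonneg) auto
  also have "\<dots> = (\<Sum>i<n. (d * (real n - 1) + d\<^sup>2) - (real n - 1 + 2 * d) * deg i + (deg i)\<^sup>2)"
    by (intro sum.cong) (auto simp: algebra_simps power2_eq_square)
  also have "\<dots> = real n * (d * (real n - 1) + d\<^sup>2) - (real n - 1 + 2 * d) * S + (\<Sum>i<n. (deg i)\<^sup>2)"
    by (simp add: sum.distrib sum_subtractf S_def sum_distrib_left)
  finally have "real n * d * (real n - 1) \<le> d * (real n * d * T + d)"
    using quad by (simp add: algebra_simps power2_eq_square)
  then have main: "real n * (real n - 1) \<le> real n * d * T + d"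
    using d by (simp add: mult.assoc mult.left_commute[of _ d])
  have "(rho_ss_centered lap + 1 / (2 * real n)) * d = (real n * d * T + d) / (2 * real n)"
    using n by (simp add: rho_ss_centered_lap[OF list len] T_def field_simps)
  also have "\<dots> \<ge> (real n - 1) / 2"
    using main n by (simp add: field_simps)
  finally show ?thesis by (simp add: d_def)
qed

end
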